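(* Let $\mathfrak{a}=\mathfrak{a}(\mathfrak{g};\kappa,\lambda,s)$ be a Lie affgebra over a field $\mathbb{K}$ of characteristic not $2$, and let $\mathfrak{b}$ be an affine subspace of $\mathfrak{a}$. Then $\mathfrak{b}$ is a right ideaf of $\mathfrak{a}$ if and only if there exist $a\in\mathfrak{b}$ and an ideal $\mathfrak{h}$ of $\mathfrak{g}$ such that $\mathfrak{b}=a+\mathfrak{h}$ and (1) $(\kappa-\lambda)(a)+s-a\in\mathfrak{h}$; (2) $(\lambda+\mathrm{ad}_a)(\mathfrak{g})\subseteq\mathfrak{h}$; (3) $(\kappa-\lambda)(\mathfrak{h})\subseteq\mathfrak{h}$.
   Context: For a Lie algebra $(\mathfrak{g},[-,-])$ over $\mathbb{K}$, linear maps $\kappa,\lambda:\mathfrak{g}\to\mathfrak{g}$ with $\lambda([a,b])=[\lambda(a),b]+[a,\lambda(b)]-[a,\kappa(b)]$ for all $a,b\in\mathfrak{g}$, and $s\in\mathfrak{g}$, the Lie affgebra $\mathfrak{a}(\mathfrak{g};\kappa,\lambda,s)$ is the set $\mathfrak{g}$ with its affine space structure $\langle a,b,c\rangle=a-b+c$, $\alpha\triangleright_a b=(1-\alpha)a+\alpha b$, and the affine Lie bracket $\{a,b\}=[a,b]+\kappa(a)+\lambda(b-a)+s$. Here $\mathrm{ad}_a(x)=[a,x]$. Affine subspaces are non-empty. A right ideaf of $\mathfrak{a}$ is an affine subspace $\mathfrak{b}$ such that $\{b,x\}\in\mathfrak{b}$ for all $x\in\mathfrak{a}$ and $b\in\mathfrak{b}$.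 *)

theory Defs
  imports Complex_Main
begin

text \<open>
  The underlying vector space of a Lie algebra is a whole type \<open>'g\<close> with an explicit scalar
  multiplication by an arbitrary field \<open>'k\<close>. The bracket is required to be
  alternating, so that \<open>[x, y] = - [y, x]\<close>, and in characteristic not 2 the two are equivalent.
\<close>

locale lie_algebra = vector_space scale
  for scale :: "'k::field \<Rightarrow> 'g::ab_group_add \<Rightarrow> 'g" +
  fixes br :: "'g \<Rightarrow> 'g \<Rightarrow> 'g"
  assumes linear_right: "Vector_Spaces.linear scale scale (\<lambda>y. br x y)"
    and linear_left: "Vector_Spaces.linear scale scale (\<lambda>x. br x y)"
    and alternating: "br x x = 0"
    and jacobi: "br x (br y z) + br y (br z x) + br z (br x y) = 0"

definition lie_ideal ::
    "('k::field \<Rightarrow> 'g::ab_group_add \<Rightarrow> 'g) \<Rightarrow> ('g \<Rightarrow> 'g \<Rightarrow> 'g) \<Rightarrow> 'g set \<Rightarrow> bool"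
  where "lie_ideal scale br H \<longleftrightarrow>
    module.subspace scale H \<and> (\<forall>x. \<forall>h\<in>H. br x h \<in> H)"

definition ad :: "('g \<Rightarrow> 'g \<Rightarrow> 'g) \<Rightarrow> 'g \<Rightarrow> 'g \<Rightarrow> 'g"
  where "ad br a x = br a x"

text \<open>
  Affine spaces without a chosen origin: \<open>tern a b c\<close> is the heap operation
  \<open>\<langle>a, b, c\<rangle>\<close> and \<open>act \<alpha> a b\<close> is the action \<open>\<alpha> \<triangleright>\<^sub>a b\<close> of scalars.
\<close>

definition affine_subspace ::
    "('g \<Rightarrow> 'g \<Rightarrow> 'g \<Rightarrow> 'g) \<Rightarrow> ('k \<Rightarrow> 'g \<Rightarrow> 'g \<Rightarrow> 'g) \<Rightarrow> 'g set \<Rightarrow> bool"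
  where "affine_subspace tern act B \<longleftrightarrow>
    B \<noteq> {} \<and>
    (\<forall>a\<in>B. \<forall>b\<in>B. \<forall>c\<in>B. tern a b c \<in> B) \<and>
    (\<forall>\<alpha>. \<forall>a\<in>B. \<forall>b\<in>B. act \<alpha> a b \<in> B)"

definition right_ideaf ::
    "('g \<Rightarrow> 'g \<Rightarrow> 'g \<Rightarrow> 'g) \<Rightarrow> ('k \<Rightarrow> 'g \<Rightarrow> 'g \<Rightarrow> 'g) \<Rightarrow> ('g \<Rightarrow> 'g \<Rightarrow> 'g) \<Rightarrow> 'g set \<Rightarrow> bool"
  where "right_ideaf tern act abr B \<longleftrightarrow>
    affine_subspace tern act B \<and> (\<forall>x. \<forall>b\<in>B. abr b x \<in> B)"

definition vs_tern :: "'g::ab_group_add \<Rightarrow> 'g \<Rightarrow> 'g \<Rightarrow> 'g"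
  where "vs_tern a b c = a - b + c"

definition vs_act :: "('k::field \<Rightarrow> 'g::ab_group_add \<Rightarrow> 'g) \<Rightarrow> 'k \<Rightarrow> 'g \<Rightarrow> 'g \<Rightarrow> 'g"
  where "vs_act scale \<alpha> a b = scale (1 - \<alpha>) a + scale \<alpha> b"

text \<open>
  The data defining the Lie affgebra \<open>\<aa>(\<gg>; \<kappa>, lam, s)\<close>; the element \<open>s\<close> is arbitrary, so it
  appears only in the affine Lie bracket \<open>aff_bracket\<close> below. The affine structure is given by
  \<open>vs_tern\<close> and \<open>vs_act\<close>.
\<close>

locale lie_affgebra_data = lie_algebra scale br
  for scale :: "'k::field \<Rightarrow> 'g::ab_group_add \<Rightarrow> 'g"
    and br :: "'g \<Rightarrow> 'g \<Rightarrow> 'g" +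
  fixes \<kappa> lam :: "'g \<Rightarrow> 'g"
  assumes linear_kappa: "Vector_Spaces.linear scale scale \<kappa>"
    and linear_lambda: "Vector_Spaces.linear scale scale lam"
    and lambda_bracket: "lam (br a b) = br (lam a) b + br a (lam b) - br a (\<kappa> b)"

definition aff_bracket ::
    "('g::ab_group_add \<Rightarrow> 'g \<Rightarrow> 'g) \<Rightarrow> ('g \<Rightarrow> 'g) \<Rightarrow> ('g \<Rightarrow> 'g) \<Rightarrow> 'g \<Rightarrow> 'g \<Rightarrow> 'g \<Rightarrow> 'g"
  where "aff_bracket br \<kappa> lam s a b = br a b + \<kappa> a + lam (b - a) + s"

end

theory Submission
  imports Defs
begin

text \<open>
  For \<open>a \<in> B\<close> write \<open>B = a + H\<close> with a linear subspace \<open>H\<close>. Expanding,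
  \<open>{a + h, x} - a = ((\<kappa> - \<lambda>)(a) + s - a) + (\<lambda> + ad\<^sub>a)(x) + (\<kappa> - \<lambda>)(h) + [h, x]\<close>.
  The sum lies in \<open>H\<close> for all \<open>h \<in> H\<close> and all \<open>x\<close> iff each of the four summands does:
  take \<open>h = x = 0\<close>, then \<open>h = 0\<close>, then \<open>x = 0\<close>.
\<close>

text \<open>With \<open>a\<close> as origin the heap operation becomes addition, (a + u) - a + (a +
  v) = a + (u + v), and the action based at \<open>a\<close> becomes scaling, (1 - c) a + c (a + u)
  = a + c u.\<close>

lemma (in vector_space) affine_subspace_direction:
  assumes "affine_subspace vs_tern (vs_act scale) B" and "a \<in> B"
  shows "subspace {h. a + h \<in> B}"
proof (rule subspaceI)
  show "0 \<in> {h. a + h \<in> B}"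
    using assms by simp
next
  fix u v
  assume "u \<in> {h. a + h \<in> B}" "v \<in> {h. a + h \<in> B}"
  then have "vs_tern (a + u) a (a + v) \<in> B"
    using assms by (simp add: affine_subspace_def)
  then show "u + v \<in> {h. a + h \<in> B}"
    by (simp add: vs_tern_def algebra_simps)
next
  fix c u
  assume "u \<in> {h. a + h \<in> B}"
  then have "vs_act scale c a (a + u) \<in> B"
    using assms by (simp add: affine_subspace_def)
  then show "scale c u \<in> {h. a + h \<in> B}"
    by (simp add: vs_act_def scale_left_diff_distrib scale_right_distrib)
qed

context lie_algebra
begin

lemma br_add_left: "br (x + y) z = br x z + br y z"
  by (rule Vector_Spaces.linear.axioms(3)[OF linear_left, THEN module_hom.add])

lemma br_add_right: "br x (y + z) = br x y + br x z"
  by (rule Vector_Spaces.linear.axioms(3)[OF linear_right, THEN module_hom.add])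

lemma br_zero_left [simp]: "br 0 z = 0"
  using br_add_left[of 0 0 z] by simp

lemma br_zero_right [simp]: "br x 0 = 0"
  using br_add_right[of x 0 0] by simp

lemma br_antisym: "br y x = - br x y"
proof -
  have "br x y + br y x = 0"
    using alternating[of "x + y", unfolded br_add_left br_add_right]
    by (simp add: alternating add.commute)
  then show ?thesis
    by (metis minus_unique)
qed

text \<open>Needed because \<open>lie_ideal\<close> puts the element of the ideal in the second
  slot, while the affine bracket of \<open>a + h\<close> with \<open>x\<close> produces
  \<open>br h x\<close>.\<close>

lemma lie_ideal_br_left:
  assumes "lie_ideal scale br H" and "h \<in> H"
  shows "br h x \<in> H"
  using assms br_antisym[of h x] subspace_neg[of H "br x h"] by (simp add: lie_ideal_def)

end

context lie_affgebra_data
begin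

lemma kappa_add: "\<kappa> (x + y) = \<kappa> x + \<kappa> y"
  by (rule Vector_Spaces.linear.axioms(3)[OF linear_kappa, THEN module_hom.add])

lemma lambda_add: "lam (x + y) = lam x + lam y"
  by (rule Vector_Spaces.linear.axioms(3)[OF linear_lambda, THEN module_hom.add])

lemma lambda_diff: "lam (x - y) = lam x - lam y"
  using lambda_add[of "x - y" y] by (simp add: algebra_simps)

lemma kappa_zero [simp]: "\<kappa> 0 = 0"
  using kappa_add[of 0 0] by simp

lemma lambda_zero [simp]: "lam 0 = 0"
  using lambda_add[of 0 0] by simp

lemma aff_bracket_translate:
  "aff_bracket br \<kappa> lam s (a + h) x =
    a + ((\<kappa> a - lam a + s - a) + (lam x + br a x) + (\<kappa> h - lam h) + br h x)"
  by (simp add: aff_bracket_def br_add_left kappa_add lambda_add lambda_diff algebra_simps)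

text \<open>Keeping \<open>a\<close> and \<open>H\<close> fixed lets both directions of the theorem
  use it: \<open>H\<close> is the direction space of \<open>B\<close> in one and the given ideal in
  the other.\<close>

lemma right_ideaf_direction_iff:
  assumes H: "subspace H"
  shows "(\<forall>h\<in>H. \<forall>x. aff_bracket br \<kappa> lam s (a + h) x \<in> (+) a ` H) \<longleftrightarrow>
    lie_ideal scale br H \<and> \<kappa> a - lam a + s - a \<in> H \<and>
    (\<forall>x. lam x + br a x \<in> H) \<and> (\<forall>h\<in>H. \<kappa> h - lam h \<in> H)"
    (is "?L \<longleftrightarrow> ?R")
proof
  let ?d = "\<kappa> a - lam a + s - a"
  assume ?L
  \<comment> \<open>Translation by \<open>a\<close> is injective, so a + v lies in the coset a +
    \<open>H\<close> exactly when v lies in \<open>H\<close>.\<close>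
  then have sum: "?d + (lam x + br a x) + (\<kappa> h - lam h) + br h x \<in> H" if "h \<in> H" for h x
    using that by (auto simp only: aff_bracket_translate inj_image_mem_iff[OF inj_on_add])
  have d: "?d \<in> H"
    using sum[OF subspace_0[OF H], of 0] by simp
  have l: "lam x + br a x \<in> H" for x
    using subspace_diff[OF H sum[OF subspace_0[OF H], of x] d] by simp
  have k: "\<kappa> h - lam h \<in> H" if "h \<in> H" for h
    using subspace_diff[OF H sum[OF that, of 0] d] by simp
  \<comment> \<open>Subtracting the three summands already known to lie in \<open>H\<close> isolates
    the bracket.\<close>
  have left: "br h x \<in> H" if "h \<in> H" for h x
    using subspace_diff[OF H sum[OF that, of x]
        subspace_add[OF H subspace_add[OF H d l[of x]] k[OF that]]] by simp
  have "br x h \<in> H" if "h \<in> H" for h x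
    using subspace_neg[OF H left[OF that, of x]] br_antisym[of x h] by simp
  with d l k H show ?R
    by (simp add: lie_ideal_def)
next
  assume ?R
  then show ?L
    unfolding aff_bracket_translate inj_image_mem_iff[OF inj_on_add]
    by (meson subspace_add[OF H] lie_ideal_br_left)
qed

end

theorem proposition3p2:
  fixes scale :: "'k::field \<Rightarrow> 'g::ab_group_add \<Rightarrow> 'g"
    and br :: "'g \<Rightarrow> 'g \<Rightarrow> 'g"
    and \<kappa> lam :: "'g \<Rightarrow> 'g" and s :: 'g
    and B :: "'g set"
  assumes "CHAR('k) \<noteq> 2"
    and "lie_affgebra_data scale br \<kappa> lam"
    and "affine_subspace vs_tern (vs_act scale) B"
  shows "right_ideaf vs_tern (vs_act scale) (aff_bracket br \<kappa> lam s) B \<longleftrightarrow>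
    (\<exists>a\<in>B. \<exists>H. lie_ideal scale br H \<and> B = (\<lambda>h. a + h) ` H \<and>
      (\<kappa> a - lam a) + s - a \<in> H \<and>
      (\<lambda>x. lam x + ad br a x) ` UNIV \<subseteq> H \<and>
      (\<lambda>x. \<kappa> x - lam x) ` H \<subseteq> H)"
proof -
  interpret lie_affgebra_data scale br \<kappa> lam
    by fact
  \<comment> \<open>\<open>B\<close> is already an affine subspace, so only closure under the affine
    bracket is at stake, and the points of \<open>B\<close> are the \<open>a + h\<close> with
    \<open>h\<close> in \<open>H\<close>.\<close>
  have direction: "(right_ideaf vs_tern (vs_act scale) (aff_bracket br \<kappa> lam s) B) \<longleftrightarrow>
      lie_ideal scale br H \<and> \<kappa> a - lam a + s - a \<in> H \<and>
      (\<forall>x. lam x + br a x \<in> H) \<and> (\<forall>h\<in>H. \<kappa> h - lam h \<in> H)"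
    if "subspace H" "B = (+) a ` H" for a H
    unfolding right_ideaf_direction_iff[OF that(1), symmetric]
    using assms(3) that(2) by (auto simp: right_ideaf_def)
  show ?thesis (is "?I \<longleftrightarrow> ?E")
  proof
    assume ?I
    obtain a where "a \<in> B"
      using assms(3) by (auto simp: affine_subspace_def)
    \<comment> \<open>Any point of \<open>B\<close> can serve as \<open>a\<close>; \<open>H\<close>
      is \<open>B\<close> translated back to the origin.\<close>
    define H where "H = {h. a + h \<in> B}"
    have "subspace H"
      unfolding H_def by (rule affine_subspace_direction[OF assms(3) \<open>a \<in> B\<close>])
    moreover have "B = (+) a ` H"
      \<comment> \<open>A point y of \<open>B\<close> is the image of y - \<open>a\<close>.\<close>
      by (force simp: H_def image_iff intro: exI[of _ "_ - a"])
    ultimately show ?E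
      using \<open>?I\<close> direction[of H a] \<open>a \<in> B\<close>
      by (intro bexI[of _ a] exI[of _ H]) (auto simp: ad_def)
  next
    assume ?E
    then obtain a H where "lie_ideal scale br H" "B = (+) a ` H" "\<kappa> a - lam a + s - a \<in> H"
      "range (\<lambda>x. lam x + ad br a x) \<subseteq> H" "(\<lambda>x. \<kappa> x - lam x) ` H \<subseteq> H"
      by blast
    \<comment> \<open>An ideal is in particular a subspace, so \<open>direction\<close> applies to
      it.\<close>
    then show ?I
      using direction[of H a] by (simp add: lie_ideal_def ad_def image_subset_iff)
  qed
qed

end
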